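(* Let $A\in\mathbb{R}^{m\times n}$, $b\in\mathbb{R}^m$, $f\in\mathbb{R}^n$, and let $H\in\mathbb{R}^{n\times n}$ be symmetric (not necessarily positive semidefinite). Assume that $F:=\{x\in\mathbb{R}^n: Ax=b,\ x\ge0\}$ is non-empty and bounded. Let $U,V\in\mathbb{R}^n$ be such that there exists an optimal KKT point $(x,\mu,\lambda)\in\mathbb{R}^n\times\mathbb{R}^m\times\mathbb{R}^n$ of $$\mathrm{QP}:\quad \min\ \tfrac12x^\top Hx+f^\top x\quad\text{s.t. } Ax=b,\ x\ge0$$ satisfying $x\le U$ and $\lambda\le V$. Consider the mixed-integer linear program in the variables $(x,\mu,\lambda,z)\in\mathbb{R}^n\times\mathbb{R}^m\times\mathbb{R}^n\times\{0,1\}^n$: $$\mathrm{IQP}:\quad \tfrac12\min\ f^\top x-b^\top\mu\quad\text{s.t. } Hx+f+A^\top\mu-\lambda=0,\ Ax=b,\ 0\le x_j\le z_jU_j,\ 0\le\lambda_j\le(1-z_j)V_j,\ z_j\in\{0,1\}\quad(j=1,\dots,n).$$ Then IQP has the same optimal value as QP, and for every optimal solution $(x,\mu,\lambda,z)$ of IQP, the vector $x$ is a (globally) optimal solution of QP.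
   Context: All vector inequalities are componentwise. A triple $(x,\mu,\lambda)\in\mathbb{R}^n\times\mathbb{R}^m\times\mathbb{R}^n$ is a KKT point of QP if $Hx+f+A^\top\mu-\lambda=0$, $x^\top\lambda=0$, $Ax=b$, $x\ge0$, $\lambda\ge0$. It is an optimal KKT point if, in addition, $x$ is a globally optimal solution of QP. The notation $\frac12\min$ means one half of the minimum value of the stated objective, so the optimal value of IQP is $\frac12$ times the minimum of $f^\top x-b^\top\mu$ over the feasible set. *)

theory Defs
  imports "HOL-Analysis.Analysis"
begin

text \<open>
  The order on vectors in \<open>real ^ 'n\<close> is the library's componentwise order. The predicate
  \<open>is_arg_min g P x\<close> says that \<open>x\<close> satisfies \<open>P\<close> and no \<open>y\<close> satisfying \<open>P\<close> has \<open>g y < g x\<close>.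
\<close>

definition optimal_solution :: "('a \<Rightarrow> real) \<Rightarrow> 'a set \<Rightarrow> 'a \<Rightarrow> bool" where
  "optimal_solution obj S x \<longleftrightarrow> is_arg_min obj (\<lambda>y. y \<in> S) x"

text \<open>
  The value \<open>min {obj x | x \<in> S}\<close>, as a relation. It includes the attainment of the minimum;
  there is at most one such \<open>v\<close>.
\<close>

definition has_min_value :: "('a \<Rightarrow> real) \<Rightarrow> 'a set \<Rightarrow> real \<Rightarrow> bool" where
  "has_min_value obj S v \<longleftrightarrow> (\<exists>x. optimal_solution obj S x \<and> obj x = v)"

definition qp_feasible :: "real ^ 'n ^ 'm \<Rightarrow> real ^ 'm \<Rightarrow> (real ^ 'n) set" where
  "qp_feasible A b = {x. A *v x = b \<and> 0 \<le> x}"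

definition qp_objective :: "real ^ 'n ^ 'n \<Rightarrow> real ^ 'n \<Rightarrow> real ^ 'n \<Rightarrow> real" where
  "qp_objective H f x = (1/2) * (x \<bullet> (H *v x)) + f \<bullet> x"

definition kkt_point ::
  "real ^ 'n ^ 'n \<Rightarrow> real ^ 'n \<Rightarrow> real ^ 'n ^ 'm \<Rightarrow> real ^ 'm
    \<Rightarrow> real ^ 'n \<Rightarrow> real ^ 'm \<Rightarrow> real ^ 'n \<Rightarrow> bool" where
  "kkt_point H f A b x \<mu> l \<longleftrightarrow>
     H *v x + f + transpose A *v \<mu> - l = 0 \<and> x \<bullet> l = 0 \<and> A *v x = b \<and> 0 \<le> x \<and> 0 \<le> l"

definition optimal_kkt_point ::
  "real ^ 'n ^ 'n \<Rightarrow> real ^ 'n \<Rightarrow> real ^ 'n ^ 'm \<Rightarrow> real ^ 'm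
    \<Rightarrow> real ^ 'n \<Rightarrow> real ^ 'm \<Rightarrow> real ^ 'n \<Rightarrow> bool" where
  "optimal_kkt_point H f A b x \<mu> l \<longleftrightarrow>
     kkt_point H f A b x \<mu> l \<and> optimal_solution (qp_objective H f) (qp_feasible A b) x"

definition iqp_feasible ::
  "real ^ 'n ^ 'n \<Rightarrow> real ^ 'n \<Rightarrow> real ^ 'n ^ 'm \<Rightarrow> real ^ 'm \<Rightarrow> real ^ 'n \<Rightarrow> real ^ 'n
    \<Rightarrow> ((real ^ 'n) \<times> (real ^ 'm) \<times> (real ^ 'n) \<times> (real ^ 'n)) set" where
  "iqp_feasible H f A b U V =
     {(x, \<mu>, l, z). H *v x + f + transpose A *v \<mu> - l = 0 \<and> A *v x = b \<and>
        (\<forall>j. 0 \<le> x $ j \<and> x $ j \<le> z $ j * U $ j \<and>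
             0 \<le> l $ j \<and> l $ j \<le> (1 - z $ j) * V $ j \<and>
             z $ j \<in> {0, 1})}"

text \<open>
  The linear function being minimised, without the outer factor one half: the optimal value of
  IQP is half of the minimum of this function over the feasible set.
\<close>

definition iqp_objective ::
  "real ^ 'n \<Rightarrow> real ^ 'm \<Rightarrow> (real ^ 'n) \<times> (real ^ 'm) \<times> (real ^ 'n) \<times> (real ^ 'n) \<Rightarrow> real" where
  "iqp_objective f b = (\<lambda>(x, \<mu>, l, z). f \<bullet> x - b \<bullet> \<mu>)"

definition qp_optimal_value ::
  "real ^ 'n ^ 'n \<Rightarrow> real ^ 'n \<Rightarrow> real ^ 'n ^ 'm \<Rightarrow> real ^ 'm \<Rightarrow> real \<Rightarrow> bool" where
  "qp_optimal_value H f A b v \<longleftrightarrow> has_min_value (qp_objective H f) (qp_feasible A b) v"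

definition iqp_optimal_value ::
  "real ^ 'n ^ 'n \<Rightarrow> real ^ 'n \<Rightarrow> real ^ 'n ^ 'm \<Rightarrow> real ^ 'm \<Rightarrow> real ^ 'n \<Rightarrow> real ^ 'n
    \<Rightarrow> real \<Rightarrow> bool" where
  "iqp_optimal_value H f A b U V v \<longleftrightarrow>
     (\<exists>w. has_min_value (iqp_objective f b) (iqp_feasible H f A b U V) w \<and> v = (1/2) * w)"

end

theory Submission
  imports Defs
begin

text \<open>
  At a KKT point the quadratic objective is a linear function of the primal and dual variables.
  Taking the inner product of the stationarity equation with \<open>x\<close> and using \<open>x \<bullet> l = 0\<close> and
  \<open>A *v x = b\<close> gives \<open>x \<bullet> (H *v x) + f \<bullet> x + b \<bullet> \<mu> = 0\<close>, so that \<open>f \<bullet> x - b \<bullet> \<mu>\<close> is exactly twice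
  the objective of QP at \<open>x\<close> (lemma \<open>kkt_objective\<close>).

  The binary vector \<open>z\<close> encodes complementarity: every point of IQP is a KKT point
  (lemma \<open>iqp_feasible_imp_kkt\<close>), and a KKT point that obeys the bounds \<open>U\<close> and \<open>V\<close> extends to a
  point of IQP by the indicator of its support (lemma \<open>kkt_imp_iqp_feasible\<close>). Half the IQP
  objective is thus a value of the QP objective on the feasible set, hence at least the QP
  minimum, and the optimal KKT point within the bounds attains this minimum. So the two values
  agree, and every minimiser of IQP projects to a minimiser of QP.
\<close>

lemma kkt_objective:
  assumes "kkt_point H f A b x \<mu> l"
  shows "f \<bullet> x - b \<bullet> \<mu> = 2 * qp_objective H f x"
proof -
  have *: "H *v x + f + transpose A *v \<mu> - l = 0" "x \<bullet> l = 0" "A *v x = b"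
    using assms by (auto simp: kkt_point_def)
  have "x \<bullet> (H *v x) + x \<bullet> f + x \<bullet> (transpose A *v \<mu>) - x \<bullet> l = x \<bullet> 0"
    unfolding *(1)[symmetric] by (simp add: inner_add_right inner_diff_right)
  moreover have "x \<bullet> (transpose A *v \<mu>) = b \<bullet> \<mu>"
    using *(3) dot_lmul_matrix[of \<mu> A x] by (simp add: inner_commute)
  ultimately show ?thesis
    using *(2) by (simp add: qp_objective_def inner_commute)
qed

lemma iqp_feasible_imp_kkt:
  assumes "(x, \<mu>, l, z) \<in> iqp_feasible H f A b U V"
  shows "kkt_point H f A b x \<mu> l"
proof -
  have *: "H *v x + f + transpose A *v \<mu> - l = 0" "A *v x = b"
    "\<And>j. 0 \<le> x $ j" "\<And>j. x $ j \<le> z $ j * U $ j"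
    "\<And>j. 0 \<le> l $ j" "\<And>j. l $ j \<le> (1 - z $ j) * V $ j" "\<And>j. z $ j = 0 \<or> z $ j = 1"
    using assms by (auto simp: iqp_feasible_def)
  have "x $ j * l $ j = 0" for j
    using *(3-7)[of j] by auto
  then have "x \<bullet> l = 0"
    unfolding inner_vec_def by (intro sum.neutral) simp
  then show ?thesis
    using * by (simp add: kkt_point_def less_eq_vec_def)
qed

lemma kkt_imp_iqp_feasible:
  assumes "kkt_point H f A b x \<mu> l" "x \<le> U" "l \<le> V"
  shows "(x, \<mu>, l, \<chi> j. if x $ j = 0 then 0 else 1) \<in> iqp_feasible H f A b U V"
proof -
  have *: "H *v x + f + transpose A *v \<mu> - l = 0" "x \<bullet> l = 0" "A *v x = b"
    "\<And>j. 0 \<le> x $ j" "\<And>j. 0 \<le> l $ j" "\<And>j. x $ j \<le> U $ j" "\<And>j. l $ j \<le> V $ j"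
    using assms by (auto simp: kkt_point_def less_eq_vec_def)
  \<comment> \<open>Complementarity holds coordinatewise because every term of \<open>x \<bullet> l\<close> is nonnegative.\<close>
  have "(\<Sum>j\<in>UNIV. x $ j * l $ j) = 0"
    using *(2) by (simp add: inner_vec_def)
  then have "x $ j * l $ j = 0" for j
    using *(4,5) by (simp add: sum_nonneg_eq_0_iff)
  then have "l $ j = 0" if "x $ j \<noteq> 0" for j
    using that by (metis mult_eq_0_iff)
  then show ?thesis
    using *(1,3-7) by (simp add: iqp_feasible_def del: transpose_matrix_vector)
qed

lemma iqp_feasible_imp_qp_feasible:
  assumes "(x, \<mu>, l, z) \<in> iqp_feasible H f A b U V"
  shows "x \<in> qp_feasible A b"
  using iqp_feasible_imp_kkt[OF assms] by (simp add: kkt_point_def qp_feasible_def)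

lemma iqp_objective_eq:
  assumes "(x, \<mu>, l, z) \<in> iqp_feasible H f A b U V"
  shows "iqp_objective f b (x, \<mu>, l, z) = 2 * qp_objective H f x"
  using kkt_objective[OF iqp_feasible_imp_kkt[OF assms]] by (simp add: iqp_objective_def)

lemma optimal_solution_iff:
  "optimal_solution obj S x \<longleftrightarrow> x \<in> S \<and> (\<forall>y\<in>S. obj x \<le> obj y)"
  by (auto simp: optimal_solution_def is_arg_min_linorder)

theorem mainTheorem2:
  fixes A :: "real ^ 'n ^ 'm" and b :: "real ^ 'm"
    and f :: "real ^ 'n" and H :: "real ^ 'n ^ 'n"
    and U V :: "real ^ 'n"
  assumes "transpose H = H"
    and "qp_feasible A b \<noteq> {}"
    and "bounded (qp_feasible A b)"
    and "\<exists>x \<mu> l. optimal_kkt_point H f A b x \<mu> l \<and> x \<le> U \<and> l \<le> V"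
  shows "(\<exists>v. iqp_optimal_value H f A b U V v \<and> qp_optimal_value H f A b v) \<and>
    (\<forall>x \<mu> l z. optimal_solution (iqp_objective f b) (iqp_feasible H f A b U V) (x, \<mu>, l, z)
       \<longrightarrow> optimal_solution (qp_objective H f) (qp_feasible A b) x)"
proof -
  let ?q = "qp_objective H f" and ?g = "iqp_objective f b"
  let ?F = "qp_feasible A b" and ?I = "iqp_feasible H f A b U V"
  obtain x \<mu> l where opt: "optimal_kkt_point H f A b x \<mu> l" and "x \<le> U" "l \<le> V"
    using assms(4) by blast
  then have qp: "optimal_solution ?q ?F x" and kkt: "kkt_point H f A b x \<mu> l"
    by (simp_all add: optimal_kkt_point_def)
  obtain z where in_I: "(x, \<mu>, l, z) \<in> ?I"
    using kkt_imp_iqp_feasible[OF kkt \<open>x \<le> U\<close> \<open>l \<le> V\<close>] by blast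
  have lower: "2 * ?q x \<le> ?g p" if "p \<in> ?I" for p
  proof -
    obtain y \<nu> k w where p: "p = (y, \<nu>, k, w)"
      by (cases p)
    show ?thesis
      using qp that iqp_feasible_imp_qp_feasible[of y \<nu> k w H f A b U V]
        iqp_objective_eq[of y \<nu> k w H f A b U V]
      by (simp add: p optimal_solution_iff)
  qed
  then have iqp: "optimal_solution ?g ?I (x, \<mu>, l, z)"
    using in_I by (simp add: optimal_solution_iff iqp_objective_eq)
  have "has_min_value ?g ?I (2 * ?q x)"
    unfolding has_min_value_def using iqp iqp_objective_eq[OF in_I] by blast
  then have "iqp_optimal_value H f A b U V (?q x)"
    unfolding iqp_optimal_value_def by (intro exI[of _ "2 * ?q x"]) simp
  moreover have "qp_optimal_value H f A b (?q x)"
    unfolding qp_optimal_value_def has_min_value_def using qp by blast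
  moreover have "optimal_solution ?q ?F y" if "optimal_solution ?g ?I (y, \<nu>, k, w)" for y \<nu> k w
  proof -
    have y: "(y, \<nu>, k, w) \<in> ?I" and "?g (y, \<nu>, k, w) \<le> ?g (x, \<mu>, l, z)"
      using that in_I by (auto simp: optimal_solution_iff)
    then have "?q y \<le> ?q x"
      using iqp_objective_eq[OF y] iqp_objective_eq[OF in_I] by simp
    then show ?thesis
      using qp iqp_feasible_imp_qp_feasible[OF y] by (fastforce simp: optimal_solution_iff)
  qed
  ultimately show ?thesis
    by blast
qed

end
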